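(* Let $u\in BUSC([0,T]\times\mathbb{R}^n)$ and $v\in BLSC([0,T]\times\mathbb{R}^n)$ be, respectively, a bounded upper semicontinuous viscosity subsolution and a bounded lower semicontinuous viscosity supersolution of $$v_t-\int_{\mathbb{T}^m}|\sigma(x,y)^TDv|^2\,d\mu(y)=0\quad\text{in }(0,T)\times\mathbb{R}^n$$ such that $u(0,x)\le v(0,x)$ for all $x\in\mathbb{R}^n$. Then $u(t,x)\le v(t,x)$ for all $x\in\mathbb{R}^n$ and $0\le t\le T$.
   Context: Standing assumptions: $n,m,r\ge1$ are integers, $T>0$, $W_t$ is a standard $r$-dimensional Brownian motion; $\sigma$ from $\mathbb{R}^n\times\mathbb{R}^m$ to the $n\times r$ real matrices is bounded, Lipschitz continuous in $(x,y)$ and $\mathbb{Z}^m$-periodic in $y$; $b:\mathbb{R}^m\to\mathbb{R}^m$ and $\tau$ from $\mathbb{R}^m$ to the $m\times r$ real matrices are locally Lipschitz and $\mathbb{Z}^m$-periodic; for some $\theta>0$, $|\tau^T(y)\xi|^2>\theta|\xi|^2$ for all $y\in\mathbb{R}^m$, $\xi\in\mathbb{R}^m\setminus\{0\}$. $\mathbb{T}^m=\mathbb{R}^m/\mathbb{Z}^m$ and $\mu$ is the invariant probability measure on $\mathbb{T}^m$ of $dY_t=b(Y_t)dt+\sqrt2\,\tau(Y_t)dW_t$. $BUSC$ and $BLSC$ denote bounded upper and bounded lower semicontinuous functions.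
   Formalization: The inequality at t = T fails as stated (u = 1 at t = T and 0 before, v = 0); it is proved for 0 ≤ t < T as stated, and at t = T when u(T,·) and v(T,·) are the limsup and liminf of the values of u and v at times in (0,T). *)

theory Defs
  imports "HOL-Probability.Probability"
begin

section \<open>Periodicity, local Lipschitz continuity and the torus\<close>

text \<open>An \<open>n \<times> r\<close> matrix is an element of \<^typ>\<open>real^'r^'n\<close>.\<close>

definition periodic :: "(real^'m \<Rightarrow> 'b) \<Rightarrow> bool" where
  "periodic f \<longleftrightarrow> (\<forall>y k. (\<forall>i. k $ i \<in> \<int>) \<longrightarrow> f (y + k) = f y)"

definition locally_lipschitz :: "('a::metric_space \<Rightarrow> 'b::metric_space) \<Rightarrow> bool" where
  "locally_lipschitz f \<longleftrightarrow> (\<forall>y. \<exists>e>0. \<exists>L. L-lipschitz_on (ball y e) f)"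

text \<open>
  The torus \<open>\<real>\<^sup>m/\<int>\<^sup>m\<close> with its Borel sets is identified with the fundamental domain
  \<open>[0,1)\<^sup>m\<close>, each class being represented by its unique point there.  This is an isomorphism
  of measurable spaces, though not a homeomorphism; only measures on the torus and
  integrals of periodic functions are used below.
\<close>

definition torus :: "(real^'m) measure" where
  "torus = restrict_space borel {y. \<forall>i. 0 \<le> y $ i \<and> y $ i < 1}"

definition torus_proj :: "real^'m \<Rightarrow> real^'m" where
  "torus_proj y = (\<chi> i. frac (y $ i))"


section \<open>Brownian motion, the Ito integral and stochastic differential equations\<close>

definition brownian_motion :: "'w measure \<Rightarrow> (real \<Rightarrow> 'w \<Rightarrow> real^'r) \<Rightarrow> bool" where
  "brownian_motion M W \<longleftrightarrow>
     prob_space M \<and>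
     (\<forall>t\<ge>0. W t \<in> borel_measurable M) \<and>
     (AE \<omega> in M. W 0 \<omega> = 0) \<and>
     (AE \<omega> in M. continuous_on {0..} (\<lambda>t. W t \<omega>)) \<and>
     (\<forall>(N::nat) (s::nat \<Rightarrow> real). 0 \<le> s 0 \<and> incseq s \<longrightarrow>
        prob_space.indep_vars M (\<lambda>_. borel) (\<lambda>k \<omega>. W (s (Suc k)) \<omega> - W (s k) \<omega>) {..<N}) \<and>
     (\<forall>s t. 0 \<le> s \<and> s < t \<longrightarrow>
        prob_space.indep_vars M (\<lambda>_. borel) (\<lambda>i \<omega>. (W t \<omega> - W s \<omega>) $ i) UNIV \<and>
        (\<forall>i. distributed M lborel (\<lambda>\<omega>. (W t \<omega> - W s \<omega>) $ i) (normal_density 0 (sqrt (t - s)))))"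

text \<open>The natural filtration of \<open>W\<close>, augmented by the null sets.\<close>

definition brownian_filtration ::
    "'w measure \<Rightarrow> (real \<Rightarrow> 'w \<Rightarrow> real^'r) \<Rightarrow> real \<Rightarrow> 'w measure" where
  "brownian_filtration M W t =
     sigma (space M)
       ({W s -` B \<inter> space M | s B. 0 \<le> s \<and> s \<le> t \<and> B \<in> sets borel} \<union> null_sets M)"

text \<open>
  A simple process on \<open>[0,t]\<close> takes the value \<open>\<xi> i\<close> on \<open>[p i, p (i+1))\<close> for \<open>i < N\<close>,
  where \<open>\<xi> i\<close> is bounded and known at time \<open>p i\<close>.
\<close>

definition simple_process ::
    "'w measure \<Rightarrow> (real \<Rightarrow> 'w measure) \<Rightarrow> real \<Rightarrow>
     nat \<Rightarrow> (nat \<Rightarrow> real) \<Rightarrow> (nat \<Rightarrow> 'w \<Rightarrow> real^'r^'m) \<Rightarrow> bool" where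
  "simple_process M F t N p \<xi> \<longleftrightarrow>
     0 \<le> p 0 \<and> p N \<le> t \<and>
     (\<forall>i<N. p i \<le> p (Suc i) \<and> \<xi> i \<in> borel_measurable (F (p i)) \<and> bounded (\<xi> i ` space M))"

definition simple_value ::
    "nat \<Rightarrow> (nat \<Rightarrow> real) \<Rightarrow> (nat \<Rightarrow> 'w \<Rightarrow> real^'r^'m) \<Rightarrow> real \<Rightarrow> 'w \<Rightarrow> real^'r^'m" where
  "simple_value N p \<xi> s \<omega> = (\<Sum>i<N. indicator {p i..<p (Suc i)} s *\<^sub>R \<xi> i \<omega>)"

definition simple_integral ::
    "(real \<Rightarrow> 'w \<Rightarrow> real^'r) \<Rightarrow> nat \<Rightarrow> (nat \<Rightarrow> real) \<Rightarrow> (nat \<Rightarrow> 'w \<Rightarrow> real^'r^'m) \<Rightarrow>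
     'w \<Rightarrow> real^'m" where
  "simple_integral W N p \<xi> \<omega> = (\<Sum>i<N. \<xi> i \<omega> *v (W (p (Suc i)) \<omega> - W (p i) \<omega>))"

text \<open>
  \<open>has_ito_integral M W H t I\<close>: the random variable \<open>I\<close> is (a version of) the Ito integral of
  \<open>H\<close> over \<open>[0,t]\<close> with respect to \<open>W\<close>, i.e. the \<open>L\<^sup>2\<close> limit of the integrals of simple
  processes converging to \<open>H\<close> in \<open>L\<^sup>2([0,t] \<times> \<Omega>)\<close>.
\<close>

definition has_ito_integral ::
    "'w measure \<Rightarrow> (real \<Rightarrow> 'w \<Rightarrow> real^'r) \<Rightarrow> (real \<Rightarrow> 'w \<Rightarrow> real^'r^'m) \<Rightarrow> real \<Rightarrow>
     ('w \<Rightarrow> real^'m) \<Rightarrow> bool" where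
  "has_ito_integral M W H t I \<longleftrightarrow>
     (\<lambda>(s, \<omega>). H s \<omega>) \<in> borel_measurable (restrict_space borel {0..t} \<Otimes>\<^sub>M M) \<and>
     (\<forall>s\<in>{0..t}. H s \<in> borel_measurable (brownian_filtration M W s)) \<and>
     I \<in> borel_measurable M \<and>
     (\<exists>N p \<xi>.
        (\<forall>k::nat. simple_process M (brownian_filtration M W) t (N k) (p k) (\<xi> k)) \<and>
        (\<lambda>k. \<integral>\<^sup>+\<omega>. (\<integral>\<^sup>+s\<in>{0..t}.
              ennreal ((norm (simple_value (N k) (p k) (\<xi> k) s \<omega> - H s \<omega>))\<^sup>2) \<partial>lborel) \<partial>M)
          \<longlonglongrightarrow> 0 \<and>
        (\<lambda>k. \<integral>\<^sup>+\<omega>. ennreal ((norm (simple_integral W (N k) (p k) (\<xi> k) \<omega> - I \<omega>))\<^sup>2) \<partial>M)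
          \<longlonglongrightarrow> 0)"

text \<open>
  \<open>Y\<close> is a strong solution of \<open>dY = b(Y) dt + a(Y) dW\<close>, \<open>Y\<^sub>0 = y\<close>; the case \<open>t = 0\<close> of the
  integral equation gives the initial condition.
\<close>

definition sde_solution ::
    "'w measure \<Rightarrow> (real \<Rightarrow> 'w \<Rightarrow> real^'r) \<Rightarrow> (real^'m \<Rightarrow> real^'m) \<Rightarrow> (real^'m \<Rightarrow> real^'r^'m) \<Rightarrow>
     real^'m \<Rightarrow> (real \<Rightarrow> 'w \<Rightarrow> real^'m) \<Rightarrow> bool" where
  "sde_solution M W b a y Y \<longleftrightarrow>
     (\<forall>t\<ge>0. Y t \<in> borel_measurable (brownian_filtration M W t)) \<and>
     (AE \<omega> in M. continuous_on {0..} (\<lambda>t. Y t \<omega>)) \<and>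
     (\<forall>t\<ge>0. \<exists>I. has_ito_integral M W (\<lambda>s \<omega>. a (Y s \<omega>)) t I \<and>
        (AE \<omega> in M. Y t \<omega> = y + (LINT s:{0..t}|lborel. b (Y s \<omega>)) + I \<omega>))"

text \<open>
  \<open>\<mu>\<close> is an invariant probability measure on the torus of the diffusion
  \<open>dY = b(Y) dt + a(Y) dW\<close>, i.e. \<open>\<mu>(A) = \<integral> P(Y\<^sup>y\<^sub>t \<in> A) d\<mu>(y)\<close>, where \<open>Y\<^sup>y\<close> is the solution
  started at \<open>y\<close>.  For locally Lipschitz periodic coefficients the family of solutions exists
  and is unique up to indistinguishability, so its choice is immaterial.
\<close>

definition invariant_measure ::
    "'w measure \<Rightarrow> (real \<Rightarrow> 'w \<Rightarrow> real^'r) \<Rightarrow> (real^'m \<Rightarrow> real^'m) \<Rightarrow> (real^'m \<Rightarrow> real^'r^'m) \<Rightarrow>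
     (real^'m) measure \<Rightarrow> bool" where
  "invariant_measure M W b a \<mu> \<longleftrightarrow>
     prob_space \<mu> \<and> sets \<mu> = sets torus \<and>
     (\<exists>Y. (\<forall>y. sde_solution M W b a y (Y y)) \<and>
       (\<forall>t\<ge>0. \<forall>A\<in>sets torus.
          emeasure \<mu> A = (\<integral>\<^sup>+y. emeasure M {\<omega> \<in> space M. torus_proj (Y y t \<omega>) \<in> A} \<partial>\<mu>)))"


section \<open>Semicontinuity and viscosity solutions\<close>

definition BUSC :: "'a::topological_space set \<Rightarrow> ('a \<Rightarrow> real) set" where
  "BUSC S = {u. bounded (u ` S) \<and>
     (\<forall>z\<in>S. \<forall>e>0. \<forall>\<^sub>F w in at z within S. u w < u z + e)}"

definition BLSC :: "'a::topological_space set \<Rightarrow> ('a \<Rightarrow> real) set" where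
  "BLSC S = {v. bounded (v ` S) \<and>
     (\<forall>z\<in>S. \<forall>e>0. \<forall>\<^sub>F w in at z within S. v w > v z - e)}"

text \<open>\<open>\<phi>\<close> is continuously differentiable on the open set \<open>S\<close> with gradient \<open>D\<close>.\<close>

definition C1_with_gradient ::
    "'a::real_inner set \<Rightarrow> ('a \<Rightarrow> real) \<Rightarrow> ('a \<Rightarrow> 'a) \<Rightarrow> bool" where
  "C1_with_gradient S \<phi> D \<longleftrightarrow> (\<forall>z\<in>S. GDERIV \<phi> z :> D z) \<and> continuous_on S D"

text \<open>
  Viscosity sub- and supersolutions of \<open>G(x, u\<^sub>t, Du) = 0\<close> in the open set \<open>S\<close> of space-time;
  the gradient of a test function at a point is the pair of its time derivative
  and its space gradient.
\<close>

definition viscosity_subsolution ::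
    "(real \<times> (real^'n)) set \<Rightarrow> (real^'n \<Rightarrow> real \<Rightarrow> real^'n \<Rightarrow> real) \<Rightarrow>
     (real \<times> (real^'n) \<Rightarrow> real) \<Rightarrow> bool" where
  "viscosity_subsolution S G u \<longleftrightarrow>
     (\<forall>\<phi> D t x. C1_with_gradient S \<phi> D \<and> (t, x) \<in> S \<and>
        (\<forall>\<^sub>F w in nhds (t, x). u w - \<phi> w \<le> u (t, x) - \<phi> (t, x)) \<longrightarrow>
        G x (fst (D (t, x))) (snd (D (t, x))) \<le> 0)"

definition viscosity_supersolution ::
    "(real \<times> (real^'n)) set \<Rightarrow> (real^'n \<Rightarrow> real \<Rightarrow> real^'n \<Rightarrow> real) \<Rightarrow>
     (real \<times> (real^'n) \<Rightarrow> real) \<Rightarrow> bool" where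
  "viscosity_supersolution S G v \<longleftrightarrow>
     (\<forall>\<phi> D t x. C1_with_gradient S \<phi> D \<and> (t, x) \<in> S \<and>
        (\<forall>\<^sub>F w in nhds (t, x). v w - \<phi> w \<ge> v (t, x) - \<phi> (t, x)) \<longrightarrow>
        G x (fst (D (t, x))) (snd (D (t, x))) \<ge> 0)"

text \<open>
  For a function on \<open>[0,T] \<times> \<real>\<^sup>n\<close>, an equation in \<open>(0,T) \<times> \<real>\<^sup>n\<close> does not constrain the values
  at the final time: \<open>u = 1\<close> at \<open>t = T\<close> and \<open>u = 0\<close> before is upper semicontinuous and a
  subsolution of \<open>u\<^sub>t = H(x,Du)\<close> whenever \<open>H(x,0) = 0\<close>.  The usual convention is that the
  values at \<open>T\<close> of a sub- (super-)solution are those of its upper (lower) semicontinuous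
  extension from \<open>t < T\<close>.
\<close>

definition usc_extended_to :: "real \<Rightarrow> (real \<times> (real^'n) \<Rightarrow> real) \<Rightarrow> bool" where
  "usc_extended_to T u \<longleftrightarrow>
     (\<forall>x. ereal (u (T, x)) = Limsup (at (T, x) within {0<..<T} \<times> UNIV) (\<lambda>z. ereal (u z)))"

definition lsc_extended_to :: "real \<Rightarrow> (real \<times> (real^'n) \<Rightarrow> real) \<Rightarrow> bool" where
  "lsc_extended_to T v \<longleftrightarrow>
     (\<forall>x. ereal (v (T, x)) = Liminf (at (T, x) within {0<..<T} \<times> UNIV) (\<lambda>z. ereal (v z)))"

text \<open>The left-hand side of \<open>v\<^sub>t - \<integral> |\<sigma>(x,y)\<^sup>T Dv|\<^sup>2 d\<mu>(y) = 0\<close>.\<close>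

definition limit_equation ::
    "(real^'n \<Rightarrow> real^'m \<Rightarrow> real^'r^'n) \<Rightarrow> (real^'m) measure \<Rightarrow>
     real^'n \<Rightarrow> real \<Rightarrow> real^'n \<Rightarrow> real" where
  "limit_equation \<sigma> \<mu> x q p = q - (LINT y|\<mu>. (norm (transpose (\<sigma> x y) *v p))\<^sup>2)"

end

theory Submission
  imports Defs
begin

text \<open>
  Write \<open>H x p = \<integral> |\<sigma>(x,y)\<^sup>T p|\<^sup>2 d\<mu>(y)\<close>, so that the equation is \<open>v\<^sub>t = H x (Dv)\<close>.  The
  Hamiltonian is convex and homogeneous of degree two in \<open>p\<close>, but \<open>\<sigma>\<close> may degenerate, so that
  gradients cannot be bounded by coercivity, and the solutions are merely
  semicontinuous.  The proof doubles the variables and overcomes the quadratic growth by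
  comparing \<open>u\<close> with \<open>\<alpha> v\<close> for some \<open>\<alpha> < 1\<close> close to one.  By homogeneity \<open>\<alpha> v\<close> is
  a supersolution of the equation with the larger Hamiltonian \<open>H / \<alpha>\<close>, and
  (\<open>effective_hamiltonian_perturb\<close>)
  \<open>H x (p + q) \<le> H x' p / \<alpha> + (B |q| + L |x - x'| |p|)\<^sup>2 / (1 - \<alpha>)\<close>,
  because \<open>p \<mapsto> |\<sigma>\<^sup>T p|\<close> is a seminorm that is Lipschitz in \<open>x\<close> with constant \<open>L |p|\<close>.

  Suppose \<open>u\<close> exceeds \<open>v\<close> somewhere.  Consider the maximum of
  \<open>u(z) - \<alpha> v(w) - k |z - w|\<^sup>2 - \<gamma> t - \<beta> |x|\<^sup>2 - \<eta> / (T - t) - \<eta> / (T - s)\<close>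
  over \<open>z = (t, x)\<close> and \<open>w = (s, y)\<close>, which exists by \<open>penalized_doubling_attains_max\<close>.
  The initial inequality and semicontinuity keep it away from the time zero
  (\<open>usc_bound_near_diagonal\<close>).  The two viscosity inequalities
  (\<open>viscosity_inequality_at_doubled_max\<close>) give, with \<open>p\<close> of size \<open>2 k |x - y|\<close>,
  \<open>\<gamma> \<le> H x (p + 2 \<beta> x) - H y p / \<alpha> \<le> (2 B \<beta> |x| + 2 L k |x - y|\<^sup>2)\<^sup>2 / (1 - \<alpha>)\<close>.
  Here \<open>\<beta> |x|\<close> is of order \<open>\<surd>\<beta>\<close> since \<open>\<beta> |x|\<^sup>2\<close> is bounded, and \<open>k |x - y|\<^sup>2\<close> is small for
  suitable large \<open>k\<close> (\<open>doubling_near_max\<close>), while \<open>\<gamma>\<close> depends on neither; this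
  is a contradiction.

  At the final time no equation is available, and \<open>u\<close> and \<open>v\<close> are limits of their values
  at earlier times along unrelated sequences.  Therefore the excess is assumed only at
  pairs of nearby points before \<open>T\<close> (\<open>comparison_up_to_closure\<close>), which the doubled
  functional handles as easily as a single point.
\<close>

section \<open>Upper semicontinuity\<close>

definition usc_on :: "'a::metric_space set \<Rightarrow> ('a \<Rightarrow> real) \<Rightarrow> bool" where
  "usc_on S f \<longleftrightarrow> (\<forall>z\<in>S. \<forall>e>0. \<exists>\<delta>>0. \<forall>w\<in>S. dist w z < \<delta> \<longrightarrow> f w < f z + e)"

lemma usc_on_iff_eventually:
  "usc_on S f \<longleftrightarrow> (\<forall>z\<in>S. \<forall>e>0. \<forall>\<^sub>F w in at z within S. f w < f z + e)"
  unfolding usc_on_def eventually_at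
  by (metis less_add_same_cancel1)

lemma usc_onD:
  assumes "usc_on S f" "z \<in> S" "f z < a"
  obtains \<delta> where "\<delta> > 0" "\<And>w. w \<in> S \<Longrightarrow> dist w z < \<delta> \<Longrightarrow> f w < a"
proof -
  have "a - f z > 0" using assms(3) by simp
  with assms(1,2) obtain \<delta> where "\<delta> > 0" "\<forall>w\<in>S. dist w z < \<delta> \<longrightarrow> f w < f z + (a - f z)"
    unfolding usc_on_def by blast
  then show thesis using that by simp
qed

lemma usc_on_subset: "usc_on S f \<Longrightarrow> R \<subseteq> S \<Longrightarrow> usc_on R f"
  unfolding usc_on_def by (meson subsetD)

lemma continuous_imp_usc_on:
  assumes "continuous_on S f"
  shows "usc_on S f"
  unfolding usc_on_def
proof (intro ballI allI impI)
  fix z and e :: real assume "z \<in> S" "e > 0"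
  with assms obtain \<delta> where "\<delta> > 0" "\<forall>w\<in>S. dist w z < \<delta> \<longrightarrow> dist (f w) (f z) < e"
    unfolding continuous_on_iff by metis
  then show "\<exists>\<delta>>0. \<forall>w\<in>S. dist w z < \<delta> \<longrightarrow> f w < f z + e"
    by (intro exI[of _ \<delta>]) (force simp: dist_real_def)
qed

lemma usc_on_add:
  assumes "usc_on S f" "usc_on S g"
  shows "usc_on S (\<lambda>z. f z + g z)"
  unfolding usc_on_def
proof (intro ballI allI impI)
  fix z and e :: real assume z: "z \<in> S" "e > 0"
  then obtain d1 where d1: "d1 > 0" "\<And>w. w \<in> S \<Longrightarrow> dist w z < d1 \<Longrightarrow> f w < f z + e / 2"
    using assms(1) half_gt_zero unfolding usc_on_def by metis
  from z obtain d2 where d2: "d2 > 0" "\<And>w. w \<in> S \<Longrightarrow> dist w z < d2 \<Longrightarrow> g w < g z + e / 2"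
    using assms(2) half_gt_zero unfolding usc_on_def by metis
  have "f w + g w < f z + g z + e" if "w \<in> S" "dist w z < min d1 d2" for w
    using d1(2)[of w] d2(2)[of w] that by simp
  with d1(1) d2(1) show "\<exists>\<delta>>0. \<forall>w\<in>S. dist w z < \<delta> \<longrightarrow> f w + g w < f z + g z + e"
    by (intro exI[of _ "min d1 d2"]) simp
qed

lemma usc_on_cmult:
  assumes "usc_on S f" "c > 0"
  shows "usc_on S (\<lambda>z. c * f z)"
  unfolding usc_on_def
proof (intro ballI allI impI)
  fix z and e :: real assume "z \<in> S" "e > 0"
  then have "e / c > 0" using assms(2) by simp
  with \<open>z \<in> S\<close> obtain d where "d > 0" "\<And>w. w \<in> S \<Longrightarrow> dist w z < d \<Longrightarrow> f w < f z + e / c"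
    using assms(1) unfolding usc_on_def by metis
  then show "\<exists>\<delta>>0. \<forall>w\<in>S. dist w z < \<delta> \<longrightarrow> c * f w < c * f z + e"
    using assms(2) by (intro exI[of _ d]) (auto simp: field_simps)
qed

lemma usc_on_fst: "usc_on S f \<Longrightarrow> usc_on (S \<times> R) (\<lambda>p. f (fst p))"
  unfolding usc_on_def by (force dest: le_less_trans[OF dist_fst_le])

lemma usc_on_snd: "usc_on S f \<Longrightarrow> usc_on (R \<times> S) (\<lambda>p. f (snd p))"
  unfolding usc_on_def by (force dest: le_less_trans[OF dist_snd_le])

lemma usc_on_attains_max:
  fixes f :: "'a::metric_space \<Rightarrow> real"
  assumes "compact K" "K \<noteq> {}" "usc_on K f"
  obtains z where "z \<in> K" "\<And>w. w \<in> K \<Longrightarrow> f w \<le> f z"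
proof -
  have False if no: "\<And>z. z \<in> K \<Longrightarrow> \<exists>w\<in>K. f z < f w"
  proof -
    obtain g where g: "\<And>z. z \<in> K \<Longrightarrow> g z \<in> K \<and> f z < f (g z)"
      using no by metis
    have "\<exists>\<delta>>0. \<forall>w\<in>K. dist w z < \<delta> \<longrightarrow> f w < f (g z)" if "z \<in> K" for z
      using g[OF that] usc_onD[OF assms(3) that, of "f (g z)"] by metis
    then obtain r where r: "\<And>z. z \<in> K \<Longrightarrow> r z > 0"
      "\<And>z w. z \<in> K \<Longrightarrow> w \<in> K \<Longrightarrow> dist w z < r z \<Longrightarrow> f w < f (g z)"
      by metis
    have "K \<subseteq> (\<Union>z\<in>K. ball z (r z))" using r(1) by force
    then obtain N where N: "N \<subseteq> K" "finite N" "K \<subseteq> (\<Union>z\<in>N. ball z (r z))"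
      using compactE_image[OF assms(1), of K "\<lambda>z. ball z (r z)"] by auto
    with assms(2) have "N \<noteq> {}" by auto
    define M where "M = Max ((\<lambda>z. f (g z)) ` N)"
    have "M \<in> (\<lambda>z. f (g z)) ` N" unfolding M_def using N(2) \<open>N \<noteq> {}\<close> by simp
    then obtain z where z: "z \<in> N" "M = f (g z)" by auto
    have "g z \<in> K" using g N(1) z(1) by auto
    then obtain z' where z': "z' \<in> N" "g z \<in> ball z' (r z')" using N(3) by auto
    have "f (g z) < f (g z')"
      using r(2)[of z' "g z"] z' N(1) \<open>g z \<in> K\<close> by (auto simp: dist_commute)
    also have "\<dots> \<le> M" unfolding M_def using N(2) z'(1) by simp
    finally show False using z by simp
  qed
  then show ?thesis using that not_less by metis
qed

text \<open>
  Keeps the two points of a doubled maximum away from the initial time: there the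
  inequality between the two functions is only known when both are evaluated at the same
  point, and compactness spreads it, with a small loss, to all pairs of nearby points.
\<close>

lemma usc_bound_near_diagonal:
  fixes G :: "'a::metric_space \<times> 'a \<Rightarrow> real"
  assumes "compact K" "K \<subseteq> S" "usc_on (S \<times> S) G" "\<And>z. z \<in> K \<Longrightarrow> G (z, z) < a"
  obtains \<delta> where "\<delta> > 0"
    "\<And>z z1 z2. z \<in> K \<Longrightarrow> z1 \<in> S \<Longrightarrow> z2 \<in> S \<Longrightarrow> dist z z1 < \<delta> \<Longrightarrow> dist z z2 < \<delta> \<Longrightarrow> G (z1, z2) < a"
proof -
  have "\<exists>r>0. \<forall>z1\<in>S. \<forall>z2\<in>S. dist z z1 < r \<longrightarrow> dist z z2 < r \<longrightarrow> G (z1, z2) < a"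
    if "z \<in> K" for z
  proof -
    have "(z, z) \<in> S \<times> S" using assms(2) that by auto
    then obtain r where r: "r > 0" "\<And>p. p \<in> S \<times> S \<Longrightarrow> dist p (z, z) < r \<Longrightarrow> G p < a"
      using usc_onD[OF assms(3) _ assms(4)[OF \<open>z \<in> K\<close>]] by blast
    have "G (z1, z2) < a"
      if "z1 \<in> S" "z2 \<in> S" "dist z z1 < r / 2" "dist z z2 < r / 2" for z1 z2
    proof -
      have "dist (z1, z2) (z, z) \<le> dist z1 z + dist z2 z"
        unfolding dist_prod_def by (simp add: sqrt_sum_squares_le_sum)
      also have "\<dots> < r" using that by (simp add: dist_commute)
      finally show ?thesis using r(2)[of "(z1, z2)"] that by simp
    qed
    then show ?thesis using r(1) by (intro exI[of _ "r / 2"]) simp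
  qed
  then obtain r where r: "\<And>z. z \<in> K \<Longrightarrow> r z > 0"
    "\<And>z z1 z2. z \<in> K \<Longrightarrow> z1 \<in> S \<Longrightarrow> z2 \<in> S \<Longrightarrow> dist z z1 < r z \<Longrightarrow> dist z z2 < r z \<Longrightarrow> G (z1, z2) < a"
    by metis
  have "K \<subseteq> \<Union>((\<lambda>z. ball z (r z)) ` K)" using r(1) by force
  then obtain \<delta> where d: "0 < \<delta>"
    "\<And>z. z \<in> K \<Longrightarrow> \<exists>U\<in>(\<lambda>z. ball z (r z)) ` K. ball z \<delta> \<subseteq> U"
    by (rule Heine_Borel_lemma[OF assms(1)]) auto
  show ?thesis
  proof (rule that[OF d(1)])
    fix z z1 z2
    assume z: "z \<in> K" "z1 \<in> S" "z2 \<in> S" "dist z z1 < \<delta>" "dist z z2 < \<delta>"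
    obtain z' where z': "z' \<in> K" "ball z \<delta> \<subseteq> ball z' (r z')" using d(2)[OF z(1)] by auto
    have "z1 \<in> ball z' (r z')" "z2 \<in> ball z' (r z')" using z z' by auto
    then show "G (z1, z2) < a" using r(2)[of z' z1 z2] z z' by simp
  qed
qed

section \<open>Doubling of variables\<close>

text \<open>
  The supremum of \<open>F - k Q\<close> decreases in \<open>k\<close> and is bounded below, so its values at \<open>k\<close> and at
  \<open>2 k\<close> are as close as desired for suitable large \<open>k\<close>.  If \<open>q\<close> then almost maximizes
  \<open>F - 2 k Q\<close>, the second inequality at \<open>q\<close> forces \<open>k Q q\<close> to be small.  This is
  the usual fact that the penalty tends to zero in a doubling of variables, in a form that
  tolerates a further perturbation of \<open>F\<close> and does not need the supremum to be attained.
\<close>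

lemma doubling_near_max:
  fixes F :: "'b \<Rightarrow> real" and Q :: "'b \<Rightarrow> real"
  assumes Q: "\<And>p. p \<in> X \<Longrightarrow> Q p \<ge> 0"
    and bdd: "\<And>p. p \<in> X \<Longrightarrow> F p \<le> A"
    and big: "\<And>k. k > 0 \<Longrightarrow> \<exists>p\<in>X. F p - k * Q p \<ge> c"
    and "N > 0" "e > 0"
  obtains k p where "k \<ge> N" "p \<in> X" "F p - 2 * k * Q p \<ge> c - e"
    "\<And>q. q \<in> X \<Longrightarrow> F q - k * Q q \<le> F p - 2 * k * Q p + e"
proof -
  define m where "m k = (SUP p\<in>X. F p - k * Q p)" for k
  define s where "s i = m (2 ^ i * N)" for i :: nat
  obtain p0 where "p0 \<in> X" using big[OF \<open>N > 0\<close>] by auto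
  have bd: "bdd_above ((\<lambda>p. F p - k * Q p) ` X)" if "k > 0" for k
    using bdd Q that by (intro bdd_aboveI2[where M = A]) (smt (verit) mult_nonneg_nonneg)
  have pos: "2 ^ i * N > 0" for i :: nat using \<open>N > 0\<close> by simp
  have ub: "F p - k * Q p \<le> m k" if "k > 0" "p \<in> X" for k p
    unfolding m_def using that bd by (intro cSUP_upper) auto
  have lb: "c \<le> m k" if k: "k > 0" for k
    using big[OF k] ub[OF k] by (meson order_trans)
  have dec: "s (Suc i) \<le> s i" for i
  proof -
    have "m (2 ^ Suc i * N) \<le> m (2 ^ i * N)"
      unfolding m_def
    proof (rule cSUP_mono)
      show "X \<noteq> {}" using \<open>p0 \<in> X\<close> by auto
      show "bdd_above ((\<lambda>p. F p - 2 ^ i * N * Q p) ` X)" using bd pos by simp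
      fix p assume p: "p \<in> X"
      have "2 ^ i * N * Q p \<ge> 0" using Q[OF p] pos[of i] by simp
      then show "\<exists>q\<in>X. F p - 2 ^ Suc i * N * Q p \<le> F q - 2 ^ i * N * Q q"
        using p by (intro bexI[of _ p]) (auto simp: algebra_simps)
    qed
    then show ?thesis unfolding s_def .
  qed
  have "decseq s" using dec by (rule decseq_SucI)
  moreover have "c \<le> s i" for i unfolding s_def using lb pos by simp
  ultimately obtain L where L: "s \<longlonglongrightarrow> L" using decseq_convergent by blast
  have "(\<lambda>i. s i - s (Suc i)) \<longlonglongrightarrow> L - L"
    using L LIMSEQ_Suc by (intro tendsto_diff) auto
  then have "\<forall>\<^sub>F i in sequentially. s i - s (Suc i) < e / 2"
    using \<open>e > 0\<close> by (intro order_tendstoD(2)[where y = 0]) auto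
  then obtain i where i: "s i - s (Suc i) < e / 2"
    by (auto simp: eventually_sequentially)
  define k where "k = 2 ^ i * N"
  have k: "k > 0" "k \<ge> N" unfolding k_def using \<open>N > 0\<close> by (auto simp: mult_le_cancel_right1)
  have mm: "m k - m (2 * k) < e / 2" using i unfolding s_def k_def by (simp add: mult.assoc)
  have "m (2 * k) - e / 2 < m (2 * k)" using \<open>e > 0\<close> by simp
  then obtain p where p: "p \<in> X" "m (2 * k) - e / 2 < F p - 2 * k * Q p"
    using less_cSUP_iff[OF _ bd[of "2 * k"], of "m (2 * k) - e / 2"] k \<open>p0 \<in> X\<close>
    unfolding m_def by auto
  show ?thesis
  proof (rule that[OF k(2) p(1)])
    show "F p - 2 * k * Q p \<ge> c - e" using p lb[of "2 * k"] k \<open>e > 0\<close> by simp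
    fix q assume "q \<in> X"
    then show "F q - k * Q q \<le> F p - 2 * k * Q p + e" using ub[of k q] k mm p by simp
  qed
qed

section \<open>The effective Hamiltonian\<close>

definition effective_hamiltonian ::
    "(real^'n \<Rightarrow> real^'m \<Rightarrow> real^'r^'n) \<Rightarrow> (real^'m) measure \<Rightarrow> real^'n \<Rightarrow> real^'n \<Rightarrow> real" where
  "effective_hamiltonian \<sigma> \<mu> x p = (LINT y|\<mu>. (norm (transpose (\<sigma> x y) *v p))\<^sup>2)"

text \<open>
  Written as a combination of the rows of \<open>A\<close>, the product is visibly continuous and linear in
  \<open>A\<close>, and the Cauchy-Schwarz inequality bounds its norm.
\<close>

lemma transpose_matrix_vector_eq_sum:
  fixes A :: "real^'r^'n"
  shows "transpose A *v p = (\<Sum>i\<in>UNIV. p $ i *\<^sub>R A $ i)"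
  by (simp add: vec_eq_iff matrix_vector_mult_def transpose_def mult.commute)

lemma norm_transpose_matrix_vector_le:
  fixes A :: "real^'r^'n"
  shows "norm (transpose A *v p) \<le> norm A * norm p"
proof -
  have "norm (transpose A *v p) \<le> (\<Sum>i\<in>UNIV. \<bar>norm (A $ i)\<bar> * \<bar>norm (p $ i)\<bar>)"
    unfolding transpose_matrix_vector_eq_sum
    by (rule order_trans[OF norm_sum]) (simp add: mult.commute)
  also have "\<dots> \<le> norm A * norm p"
    unfolding norm_vec_def by (rule L2_set_mult_ineq)
  finally show ?thesis .
qed

text \<open>
  Convexity of the square at the point \<open>\<alpha> (a / \<alpha>) + (1 - \<alpha>) (r / (1 - \<alpha>))\<close>.
\<close>

lemma power2_add_le_convex:
  fixes a r \<alpha> :: real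
  assumes "0 < \<alpha>" "\<alpha> < 1"
  shows "(a + r)\<^sup>2 \<le> a\<^sup>2 / \<alpha> + r\<^sup>2 / (1 - \<alpha>)"
proof -
  have "a\<^sup>2 / \<alpha> + r\<^sup>2 / (1 - \<alpha>) - (a + r)\<^sup>2 = ((1 - \<alpha>) * a - \<alpha> * r)\<^sup>2 / (\<alpha> * (1 - \<alpha>))"
    using assms by (simp add: field_simps power2_eq_square)
  moreover have "\<dots> \<ge> 0" using assms by simp
  ultimately show ?thesis by linarith
qed

lemma effective_hamiltonian_scaleR:
  "effective_hamiltonian \<sigma> \<mu> x (c *\<^sub>R p) = c\<^sup>2 * effective_hamiltonian \<sigma> \<mu> x p"
  unfolding effective_hamiltonian_def
  by (simp add: matrix_vector_mult_scaleR power_mult_distrib)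

text \<open>
  The estimate that replaces coercivity.  Moving from \<open>x'\<close> to \<open>x\<close> changes
  \<open>\<sigma>\<^sup>T p\<close> by at most \<open>L |x - x'| |p|\<close>; squaring this directly would leave an uncontrolled
  cross term of order \<open>|x - x'| |p|\<^sup>2\<close>.  Allowing the factor \<open>1 / \<alpha> > 1\<close> on the main term
  leaves only the square \<open>(|x - x'| |p|)\<^sup>2\<close>, which vanishes at doubled maxima, where \<open>|p|\<close> is a
  multiple of \<open>k |x - x'|\<close> and \<open>k |x - x'|\<^sup>2\<close> is small.  The inequality holds pointwise in
  the fast variable \<open>y\<close> and is then integrated.
\<close>

lemma effective_hamiltonian_perturb:
  fixes \<sigma> :: "real^'n \<Rightarrow> real^'m \<Rightarrow> real^'r^'n"
  assumes \<mu>: "prob_space \<mu>" "sets \<mu> = sets torus"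
    and bound: "\<And>x y. norm (\<sigma> x y) \<le> B"
    and lip: "L-lipschitz_on UNIV (\<lambda>(x, y). \<sigma> x y)"
    and \<alpha>: "0 < \<alpha>" "\<alpha> < 1"
  shows "effective_hamiltonian \<sigma> \<mu> x (p + q) \<le> effective_hamiltonian \<sigma> \<mu> x' p / \<alpha>
    + (B * norm q + L * norm (x - x') * norm p)\<^sup>2 / (1 - \<alpha>)"
proof -
  interpret prob_space \<mu> by (rule \<mu>)
  define N where "N x p y = norm (transpose (\<sigma> x y) *v p)" for x p y
  define r where "r = B * norm q + L * norm (x - x') * norm p"
  have cont: "continuous_on UNIV (\<sigma> x)" for x
  proof -
    have "continuous_on UNIV (\<lambda>y. (case (x, y) of (x, y) \<Rightarrow> \<sigma> x y))"
      by (rule continuous_on_compose2[OF lipschitz_on_continuous_on[OF lip]])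
        (auto intro!: continuous_intros)
    then show ?thesis by simp
  qed
  have N_le: "N x p y \<le> B * norm p" for x p y
    unfolding N_def
    by (rule order_trans[OF norm_transpose_matrix_vector_le]) (simp add: bound mult_right_mono)
  have "continuous_on UNIV (\<lambda>y. (N x p y)\<^sup>2)" for x p
    unfolding N_def transpose_matrix_vector_eq_sum
    by (intro continuous_intros continuous_on_component cont)
  then have "(\<lambda>y. (N x p y)\<^sup>2) \<in> borel_measurable torus" for x p
    unfolding torus_def
    by (intro measurable_restrict_space1 borel_measurable_continuous_onI)
  then have meas: "(\<lambda>y. (N x p y)\<^sup>2) \<in> borel_measurable \<mu>" for x p
    using measurable_cong_sets[OF \<mu>(2) refl] by blast
  have int: "integrable \<mu> (\<lambda>y. (N x p y)\<^sup>2)" for x p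
  proof (rule integrable_const_bound[OF _ meas])
    show "AE y in \<mu>. norm ((N x p y)\<^sup>2) \<le> (B * norm p)\<^sup>2"
      using N_le by (auto simp: N_def intro!: power_mono)
  qed
  have pointwise: "(N x (p + q) y)\<^sup>2 \<le> (N x' p y)\<^sup>2 / \<alpha> + r\<^sup>2 / (1 - \<alpha>)" for y
  proof -
    have "dist (\<sigma> x y) (\<sigma> x' y) \<le> L * dist (x, y) (x', y)"
      using lipschitz_onD[OF lip, of "(x, y)" "(x', y)"] by simp
    then have d: "norm (\<sigma> x y - \<sigma> x' y) \<le> L * norm (x - x')"
      by (simp add: dist_norm norm_Pair)
    have "transpose (\<sigma> x y) *v (p + q) = transpose (\<sigma> x' y) *v p
        + (transpose (\<sigma> x y - \<sigma> x' y) *v p + transpose (\<sigma> x y) *v q)"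
      unfolding transpose_matrix_vector_eq_sum
      by (simp add: algebra_simps sum.distrib sum_subtractf)
    then have "N x (p + q) y \<le> N x' p y + (norm (transpose (\<sigma> x y - \<sigma> x' y) *v p) + N x q y)"
      unfolding N_def
      by (simp only: order_trans[OF norm_triangle_ineq add_left_mono[OF norm_triangle_ineq]])
    also have "\<dots> \<le> N x' p y + r"
      using N_le[of x q y] norm_transpose_matrix_vector_le[of "\<sigma> x y - \<sigma> x' y" p]
        mult_right_mono[OF d norm_ge_zero[of p]] unfolding r_def by simp
    finally have "(N x (p + q) y)\<^sup>2 \<le> (N x' p y + r)\<^sup>2"
      unfolding N_def by (intro power_mono) auto
    also have "\<dots> \<le> (N x' p y)\<^sup>2 / \<alpha> + r\<^sup>2 / (1 - \<alpha>)"
      using power2_add_le_convex[OF \<alpha>] .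
    finally show ?thesis .
  qed
  have "(LINT y|\<mu>. (N x (p + q) y)\<^sup>2) \<le> (LINT y|\<mu>. (N x' p y)\<^sup>2 / \<alpha> + r\<^sup>2 / (1 - \<alpha>))"
    using pointwise by (intro integral_mono int) (auto intro!: int integrable_divide)
  also have "\<dots> = (LINT y|\<mu>. (N x' p y)\<^sup>2) / \<alpha> + r\<^sup>2 / (1 - \<alpha>)"
    using int by (simp add: prob_space)
  finally show ?thesis unfolding effective_hamiltonian_def N_def r_def .
qed

section \<open>The doubled functional and its maxima\<close>

text \<open>
  One family serves both equations: with positive parameters it gives the test functions for
  \<open>u\<close>, and with \<open>a, \<eta> < 0\<close> and \<open>\<gamma> = \<beta> = 0\<close> those for \<open>v\<close>.
\<close>

lemma C1_test_function:
  fixes w :: "real \<times> (real^'n)"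
  shows "C1_with_gradient ({0<..<T} \<times> UNIV)
    (\<lambda>z. a * (norm (z - w))\<^sup>2 + \<gamma> * fst z + \<beta> * (norm (snd z))\<^sup>2 + \<eta> / (T - fst z))
    (\<lambda>z. (2 * a) *\<^sub>R (z - w) + (\<gamma> + \<eta> / (T - fst z)\<^sup>2, (2 * \<beta>) *\<^sub>R snd z))"
  unfolding C1_with_gradient_def
proof (intro conjI ballI)
  fix z :: "real \<times> (real^'n)" assume "z \<in> {0<..<T} \<times> UNIV"
  then have "T - fst z \<noteq> 0" by auto
  then show "GDERIV (\<lambda>z. a * (norm (z - w))\<^sup>2 + \<gamma> * fst z + \<beta> * (norm (snd z))\<^sup>2 + \<eta> / (T - fst z)) z
      :> (2 * a) *\<^sub>R (z - w) + (\<gamma> + \<eta> / (T - fst z)\<^sup>2, (2 * \<beta>) *\<^sub>R snd z)"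
  proof -
    have d1: "((\<lambda>z. a * ((z - w) \<bullet> (z - w))) has_derivative (\<lambda>h. h \<bullet> ((2 * a) *\<^sub>R (z - w)))) (at z)"
      by (auto intro!: derivative_eq_intros simp: fun_eq_iff inner_commute)
    have d2: "((\<lambda>z::real \<times> (real^'n). \<gamma> * fst z) has_derivative (\<lambda>h. fst h * \<gamma>)) (at z)"
      by (auto intro!: derivative_eq_intros)
    have d3: "((\<lambda>z::real \<times> (real^'n). \<beta> * (snd z \<bullet> snd z)) has_derivative
        (\<lambda>h. snd h \<bullet> ((2 * \<beta>) *\<^sub>R snd z))) (at z)"
      by (auto intro!: derivative_eq_intros simp: fun_eq_iff inner_commute)
    have "((\<lambda>t. \<eta> / (T - t)) has_field_derivative \<eta> / (T - fst z)\<^sup>2) (at (fst z))"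
      using \<open>T - fst z \<noteq> 0\<close> by (auto intro!: derivative_eq_intros simp: power2_eq_square)
    then have d4: "((\<lambda>z::real \<times> (real^'n). \<eta> / (T - fst z)) has_derivative
        (\<lambda>h. fst h * (\<eta> / (T - fst z)\<^sup>2))) (at z)"
      using has_derivative_compose[OF has_derivative_fst[OF has_derivative_ident]]
      by (fastforce simp: has_field_derivative_def mult.commute)
    show ?thesis
      unfolding gderiv_def power2_norm_eq_inner
      by (rule has_derivative_eq_rhs[OF has_derivative_add[OF has_derivative_add[OF has_derivative_add[OF d1 d2] d3] d4]])
        (auto simp: fun_eq_iff inner_add_right inner_prod_def algebra_simps)
  qed
next
  show "continuous_on ({0<..<T} \<times> UNIV)
    (\<lambda>z::real \<times> (real^'n). (2 * a) *\<^sub>R (z - w) + (\<gamma> + \<eta> / (T - fst z)\<^sup>2, (2 * \<beta>) *\<^sub>R snd z))"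
    by (intro continuous_intros) auto
qed

text \<open>
  The term \<open>\<gamma> t\<close> makes the subsolution strict and \<open>\<beta> |x|\<^sup>2\<close> confines the points in space.  The
  penalty that couples the two points is kept apart, since its weight is varied.
\<close>

definition doubled ::
    "(real \<times> (real^'n) \<Rightarrow> real) \<Rightarrow> (real \<times> (real^'n) \<Rightarrow> real) \<Rightarrow> real \<Rightarrow> real \<Rightarrow> real \<Rightarrow>
     (real \<times> (real^'n)) \<times> (real \<times> (real^'n)) \<Rightarrow> real" where
  "doubled u v \<alpha> \<gamma> \<beta> p =
     u (fst p) - \<alpha> * v (snd p) - \<gamma> * fst (fst p) - \<beta> * (norm (snd (fst p)))\<^sup>2"

definition separation :: "'a::real_normed_vector \<times> 'a \<Rightarrow> real" where
  "separation p = (norm (fst p - snd p))\<^sup>2"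

text \<open>
  The barrier excludes the final time from the maxima.  Its time derivatives have the sign that
  helps in both viscosity inequalities, so \<open>\<eta>\<close> may be chosen after all other parameters.
\<close>

definition barrier :: "real \<Rightarrow> real \<Rightarrow> (real \<times> 'a) \<times> (real \<times> 'a) \<Rightarrow> real" where
  "barrier T \<eta> p = \<eta> / (T - fst (fst p)) + \<eta> / (T - fst (snd p))"

text \<open>
  Where the functional is at least its value at the origin, the penalties bound both points
  in space and keep their times a fixed distance below \<open>T\<close>, so that the maximum may be
  sought in a compact set.
\<close>

lemma penalized_doubling_attains_max:
  fixes u v :: "real \<times> (real^'n) \<Rightarrow> real" and T :: real
  defines "S \<equiv> {0..<T} \<times> UNIV"
  assumes "T > 0" and bu: "\<And>z. z \<in> S \<Longrightarrow> \<bar>u z\<bar> \<le> C" and bv: "\<And>z. z \<in> S \<Longrightarrow> \<bar>v z\<bar> \<le> C"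
    and usc: "usc_on S u" "usc_on S (\<lambda>z. - v z)"
    and \<alpha>: "0 < \<alpha>" "\<alpha> < 1" and "k > 0" "\<gamma> \<ge> 0" "\<beta> > 0" "\<eta> > 0"
  obtains p where "p \<in> S \<times> S" 
    "\<And>q. q \<in> S \<times> S \<Longrightarrow> doubled u v \<alpha> \<gamma> \<beta> q - k * separation q - barrier T \<eta> q
       \<le> doubled u v \<alpha> \<gamma> \<beta> p - k * separation p - barrier T \<eta> p"
proof -
  define \<Phi> where "\<Phi> q = doubled u v \<alpha> \<gamma> \<beta> q - k * separation q - barrier T \<eta> q" for q
  \<comment> \<open>Any pair whose value is at least that of the origin has total penalty at most \<open>A\<close>.\<close>
  define A where "A = 4 * C + 2 * \<eta> / T"
  define R where "R = sqrt (A / \<beta>) + sqrt (A / k)"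
  define K where "K = {0..T - \<eta> / A} \<times> cball (0::real^'n) R"
  define p0 :: "(real \<times> (real^'n)) \<times> (real \<times> (real^'n))" where "p0 = ((0, 0), (0, 0))"
  have S0: "(0, 0) \<in> S" unfolding S_def using \<open>T > 0\<close> by simp
  have "C \<ge> 0" using bu[OF S0] by linarith
  then have A: "A \<ge> 2 * \<eta> / T" "A > 0" using \<open>T > 0\<close> \<open>\<eta> > 0\<close> unfolding A_def
    by (auto intro: add_nonneg_pos)
  have \<alpha>v: "\<bar>\<alpha> * v z\<bar> \<le> C" if "z \<in> S" for z
  proof -
    have "\<bar>\<alpha> * v z\<bar> \<le> 1 * \<bar>v z\<bar>" using \<alpha> by (simp add: abs_mult mult_left_le_one_le)
    then show ?thesis using bv[OF that] by linarith
  qed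
  have p0: "\<Phi> p0 \<ge> - (2 * C) - 2 * \<eta> / T"
    using bu[OF S0] \<alpha>v[OF S0]
    unfolding \<Phi>_def p0_def doubled_def separation_def barrier_def by simp
  have "\<eta> / A \<le> T"
    using A \<open>T > 0\<close> \<open>\<eta> > 0\<close> by (simp add: field_simps)
  have "R \<ge> 0" unfolding R_def using A \<open>\<beta> > 0\<close> \<open>k > 0\<close> by simp
  have p0K: "p0 \<in> K \<times> K" unfolding p0_def K_def using \<open>\<eta> / A \<le> T\<close> \<open>R \<ge> 0\<close> by simp
  have KS: "K \<subseteq> S" unfolding K_def S_def using divide_pos_pos[OF \<open>\<eta> > 0\<close> A(2)] by auto
  have outside: "q \<in> K \<times> K" if q: "q \<in> S \<times> S" and ge: "\<Phi> q \<ge> \<Phi> p0" for q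
  proof -
    obtain t x s y where qe: "q = ((t, x), (s, y))" by (metis surj_pair)
    have t: "0 \<le> t" "t < T" "0 \<le> s" "s < T" using q unfolding qe S_def by auto
    have "u (t, x) \<le> C" "- (\<alpha> * v (s, y)) \<le> C"
      using bu[of "(t, x)"] \<alpha>v[of "(s, y)"] q unfolding qe by auto
    moreover have "\<gamma> * t \<ge> 0" using \<open>\<gamma> \<ge> 0\<close> t by simp
    ultimately have sum: "k * (norm ((t, x) - (s, y)))\<^sup>2 + \<beta> * (norm x)\<^sup>2 + \<eta> / (T - t) + \<eta> / (T - s) \<le> A"
      using ge p0 unfolding A_def \<Phi>_def qe doubled_def separation_def barrier_def by simp
    have nn: "k * (norm ((t, x) - (s, y)))\<^sup>2 \<ge> 0" "\<beta> * (norm x)\<^sup>2 \<ge> 0" "\<eta> / (T - t) > 0" "\<eta> / (T - s) > 0"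
      using \<open>k > 0\<close> \<open>\<beta> > 0\<close> \<open>\<eta> > 0\<close> t by auto
    have "\<eta> / (T - t) \<le> A" "\<eta> / (T - s) \<le> A" using sum nn by linarith+
    then have "t \<le> T - \<eta> / A" "s \<le> T - \<eta> / A" using t A by (auto simp: field_simps)
    moreover have x: "norm x \<le> sqrt (A / \<beta>)"
      using sum nn \<open>\<beta> > 0\<close> by (intro real_le_rsqrt) (simp add: field_simps)
    moreover have "norm y \<le> sqrt (A / \<beta>) + sqrt (A / k)"
    proof -
      have "norm (y - x) \<le> norm ((t, x) - (s, y))"
        using norm_snd_le[of "x - y" "t - s"] by (simp add: norm_minus_commute)
      also have "\<dots> \<le> sqrt (A / k)"
        using sum nn \<open>k > 0\<close> by (intro real_le_rsqrt) (simp add: field_simps)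
      finally show ?thesis using x norm_triangle_sub[of y x] by linarith
    qed
    moreover have "sqrt (A / k) \<ge> 0" using A \<open>k > 0\<close> by simp
    ultimately have "norm x \<le> R" "norm y \<le> R" "t \<le> T - \<eta> / A" "s \<le> T - \<eta> / A"
      unfolding R_def by linarith+
    then show ?thesis unfolding qe K_def using t by simp
  qed
  have "usc_on (K \<times> K) \<Phi>"
  proof -
    have 1: "usc_on (K \<times> K) (\<lambda>q. u (fst q))"
      by (intro usc_on_fst usc_on_subset[OF usc(1) KS])
    have 2: "usc_on (K \<times> K) (\<lambda>q. \<alpha> * (- v (snd q)))"
      by (intro usc_on_cmult[OF _ \<alpha>(1)] usc_on_snd[of K "\<lambda>z. - v z"] usc_on_subset[OF usc(2) KS])
    have "T - fst (fst q) \<noteq> 0 \<and> T - fst (snd q) \<noteq> 0" if "q \<in> K \<times> K" for q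
      using that KS unfolding S_def by fastforce
    then have 3: "usc_on (K \<times> K) (\<lambda>q. - \<gamma> * fst (fst q) - \<beta> * (norm (snd (fst q)))\<^sup>2
        - k * (norm (fst q - snd q))\<^sup>2 - (\<eta> / (T - fst (fst q)) + \<eta> / (T - fst (snd q))))"
      by (intro continuous_imp_usc_on continuous_intros) auto
    show ?thesis
      using usc_on_add[OF usc_on_add[OF 1 2] 3]
      unfolding \<Phi>_def doubled_def separation_def barrier_def
      by (rule back_subst[where P = "usc_on (K \<times> K)"]) (simp add: fun_eq_iff algebra_simps)
  qed
  moreover have "compact (K \<times> K)" unfolding K_def by (intro compact_Times) auto
  ultimately obtain p where p: "p \<in> K \<times> K" "\<And>q. q \<in> K \<times> K \<Longrightarrow> \<Phi> q \<le> \<Phi> p"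
    using usc_on_attains_max[of "K \<times> K" \<Phi>] p0K by (metis empty_iff)
  show ?thesis
  proof (rule that[of p, folded \<Phi>_def])
    show "p \<in> S \<times> S" using p(1) KS by auto
    fix q assume q: "q \<in> S \<times> S"
    show "\<Phi> q \<le> \<Phi> p"
    proof (cases "\<Phi> q \<ge> \<Phi> p0")
      case True
      then show ?thesis using outside[OF q] p(2) by blast
    next
      case False
      then show ?thesis using p(2)[OF p0K] by linarith
    qed
  qed
qed

text \<open>
  Each function is tested with the remaining terms of the functional, the other point being
  fixed.  For \<open>v\<close>
  everything is divided by \<open>\<alpha>\<close>; since \<open>H\<close> is homogeneous of degree two, multiplying its
  inequality back by \<open>\<alpha>\<close> turns \<open>H y (p / \<alpha>)\<close> into \<open>H y p / \<alpha>\<close>.  The gain of the factor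
  \<open>1 / \<alpha>\<close> over \<open>H y p\<close> is the reason for comparing \<open>u\<close> with \<open>\<alpha> v\<close>.
\<close>

lemma viscosity_inequality_at_doubled_max:
  fixes u v :: "real \<times> (real^'n) \<Rightarrow> real" and H :: "real^'n \<Rightarrow> real^'n \<Rightarrow> real" and T :: real
  defines "S \<equiv> {0..<T} \<times> UNIV"
  assumes sub: "viscosity_subsolution ({0<..<T} \<times> UNIV) (\<lambda>x q p. q - H x p) u"
    and super: "viscosity_supersolution ({0<..<T} \<times> UNIV) (\<lambda>x q p. q - H x p) v"
    and homogeneous: "\<And>x c p. H x (c *\<^sub>R p) = c\<^sup>2 * H x p"
    and \<alpha>: "0 < \<alpha>" and "\<eta> > 0"
    and max: "\<And>q. q \<in> S \<times> S \<Longrightarrow> doubled u v \<alpha> \<gamma> \<beta> q - k * separation q - barrier T \<eta> q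
       \<le> doubled u v \<alpha> \<gamma> \<beta> ((t, x), (s, y)) - k * separation ((t, x), (s, y)) - barrier T \<eta> ((t, x), (s, y))"
    and t: "0 < t" "t < T" and s: "0 < s" "s < T"
  shows "\<gamma> \<le> H x ((2 * k) *\<^sub>R (x - y) + (2 * \<beta>) *\<^sub>R x) - H y ((2 * k) *\<^sub>R (x - y)) / \<alpha>"
proof -
  let ?O = "{0<..<T} \<times> (UNIV :: (real^'n) set)"
  have "open ?O" by (intro open_Times) auto
  then have near: "\<forall>\<^sub>F w in nhds z. w \<in> S" if "z \<in> ?O" for z
    using that by (rule eventually_mono[OF eventually_nhds_in_open]) (auto simp: S_def)
  have mem: "(t, x) \<in> ?O" "(s, y) \<in> ?O" using t s by auto
  have memS: "(t, x) \<in> S" "(s, y) \<in> S" using t s by (auto simp: S_def)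
  note unf = doubled_def separation_def barrier_def

  \<comment> \<open>The subsolution inequality at \<open>(t, x)\<close>.\<close>
  define \<phi> where "\<phi> z = k * (norm (z - (s, y)))\<^sup>2 + \<gamma> * fst z + \<beta> * (norm (snd z))\<^sup>2 + \<eta> / (T - fst z)" for z
  have "\<forall>\<^sub>F z in nhds (t, x). u z - \<phi> z \<le> u (t, x) - \<phi> (t, x)"
  proof (rule eventually_mono[OF near[OF mem(1)]])
    fix z assume "z \<in> S"
    then show "u z - \<phi> z \<le> u (t, x) - \<phi> (t, x)"
      using max[of "(z, (s, y))"] memS unfolding unf \<phi>_def by simp
  qed
  from sub[unfolded viscosity_subsolution_def, rule_format, OF conjI[OF C1_test_function conjI[OF mem(1) this[unfolded \<phi>_def]]]]
  have 1: "2 * k * (t - s) + (\<gamma> + \<eta> / (T - t)\<^sup>2) \<le> H x ((2 * k) *\<^sub>R (x - y) + (2 * \<beta>) *\<^sub>R x)"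
    by simp

  \<comment> \<open>The supersolution inequality at \<open>(s, y)\<close>; the vanishing terms only match the shape of the test functions.\<close>
  define \<psi> where "\<psi> z = - k / \<alpha> * (norm (z - (t, x)))\<^sup>2 + 0 * fst z + 0 * (norm (snd z))\<^sup>2
    + (- \<eta> / \<alpha>) / (T - fst z)" for z
  have "\<forall>\<^sub>F z in nhds (s, y). v z - \<psi> z \<ge> v (s, y) - \<psi> (s, y)"
  proof (rule eventually_mono[OF near[OF mem(2)]])
    fix z assume "z \<in> S"
    have scaled: "\<alpha> * \<psi> w = - k * (norm ((t, x) - w))\<^sup>2 - \<eta> / (T - fst w)" for w
    proof -
      have "\<alpha> * (- k / \<alpha>) = - k" "\<alpha> * (- \<eta> / \<alpha>) = - \<eta>" using \<alpha> by auto
      then show ?thesis unfolding \<psi>_def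
        by (simp only: distrib_left mult.assoc[symmetric] times_divide_eq_right)
          (simp add: norm_minus_commute)
    qed
    have "\<alpha> * v (s, y) - \<alpha> * \<psi> (s, y) \<le> \<alpha> * v z - \<alpha> * \<psi> z"
      using max[of "((t, x), z)"] memS \<open>z \<in> S\<close> unfolding unf scaled by simp
    then have "\<alpha> * (v (s, y) - \<psi> (s, y)) \<le> \<alpha> * (v z - \<psi> z)" by (simp add: algebra_simps)
    then show "v z - \<psi> z \<ge> v (s, y) - \<psi> (s, y)" using \<alpha> by simp
  qed
  from super[unfolded viscosity_supersolution_def, rule_format, OF conjI[OF C1_test_function conjI[OF mem(2) this[unfolded \<psi>_def]]]]
  have "H y ((2 * (- k / \<alpha>)) *\<^sub>R (y - x)) \<le> 2 * (- k / \<alpha>) * (s - t) - \<eta> / \<alpha> / (T - s)\<^sup>2"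
    by simp
  moreover have "(2 * (- k / \<alpha>)) *\<^sub>R (y - x) = (1 / \<alpha>) *\<^sub>R ((2 * k) *\<^sub>R (x - y))"
    by (simp add: scaleR_diff_right)
  ultimately have "H y ((2 * k) *\<^sub>R (x - y)) / \<alpha>\<^sup>2 \<le> 2 * (- k / \<alpha>) * (s - t) - \<eta> / \<alpha> / (T - s)\<^sup>2"
    using homogeneous[of y "1 / \<alpha>" "(2 * k) *\<^sub>R (x - y)"] by (simp add: power_divide)
  then have "\<alpha> * (H y ((2 * k) *\<^sub>R (x - y)) / \<alpha>\<^sup>2) \<le> \<alpha> * (2 * (- k / \<alpha>) * (s - t) - \<eta> / \<alpha> / (T - s)\<^sup>2)"
    using \<alpha> by (intro mult_left_mono) auto
  also have "\<dots> = 2 * k * (t - s) - \<eta> / (T - s)\<^sup>2"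
    using \<alpha> by (simp add: field_simps)
  also have "\<alpha> * (H y ((2 * k) *\<^sub>R (x - y)) / \<alpha>\<^sup>2) = H y ((2 * k) *\<^sub>R (x - y)) / \<alpha>"
    using \<alpha> by (simp add: power2_eq_square)
  finally have 2: "H y ((2 * k) *\<^sub>R (x - y)) / \<alpha> \<le> 2 * k * (t - s) - \<eta> / (T - s)\<^sup>2" .
  have "\<eta> / (T - s)\<^sup>2 \<ge> 0" "\<eta> / (T - t)\<^sup>2 \<ge> 0" using \<open>\<eta> > 0\<close> by auto
  with 1 2 show ?thesis by linarith
qed

section \<open>Comparison\<close>

text \<open>
  If \<open>u\<close> exceeded \<open>v\<close> by \<open>4 d\<close> at pairs of points arbitrarily close to \<open>z\<^sub>0\<close>, then the doubled
  functional would have supremum at least \<open>3 d / 2\<close> for every weight \<open>k\<close> of the coupling.  For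
  suitable large \<open>k\<close> it has, once the barrier is subtracted, a maximum whose points are close together.
  Near the initial time its value could be at most about \<open>d\<close>, so the maximum is interior and
  both equations hold there.  Subtracting them and estimating \<open>H\<close> bounds the fixed number
  \<open>\<gamma>\<close> by a quantity that is small with \<open>\<beta>\<close> and with \<open>k |x - y|\<^sup>2\<close>.

  The two points near \<open>z\<^sub>0\<close> are independent and \<open>z\<^sub>0\<close> is arbitrary, so that the result also
  covers the final time, where \<open>u\<close> and \<open>v\<close> are limits along different sequences.
\<close>

lemma comparison_up_to_closure:
  fixes u v :: "real \<times> (real^'n) \<Rightarrow> real" and H :: "real^'n \<Rightarrow> real^'n \<Rightarrow> real"
    and z\<^sub>0 :: "real \<times> (real^'n)" and T B L d :: real
  defines "S \<equiv> {0..<T} \<times> UNIV"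
  assumes "T > 0"
    and homogeneous: "\<And>x c p. H x (c *\<^sub>R p) = c\<^sup>2 * H x p"
    and perturb: "\<And>\<alpha> x x' p q. 0 < \<alpha> \<Longrightarrow> \<alpha> < 1 \<Longrightarrow>
      H x (p + q) \<le> H x' p / \<alpha> + (B * norm q + L * norm (x - x') * norm p)\<^sup>2 / (1 - \<alpha>)"
    and u: "u \<in> BUSC ({0..T} \<times> UNIV)" and v: "v \<in> BLSC ({0..T} \<times> UNIV)"
    and sub: "viscosity_subsolution ({0<..<T} \<times> UNIV) (\<lambda>x q p. q - H x p) u"
    and super: "viscosity_supersolution ({0<..<T} \<times> UNIV) (\<lambda>x q p. q - H x p) v"
    and init: "\<And>x. u (0, x) \<le> v (0, x)"
    and "d > 0"
  obtains \<delta> where "\<delta> > 0"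
    "\<And>z w. z \<in> S \<Longrightarrow> w \<in> S \<Longrightarrow> dist z z\<^sub>0 < \<delta> \<Longrightarrow> dist w z\<^sub>0 < \<delta> \<Longrightarrow> u z - v w < 4 * d"
proof (rule ccontr)
  assume "\<not> thesis"
  with that have gap: "\<exists>z\<in>S. \<exists>w\<in>S. dist z z\<^sub>0 < \<delta> \<and> dist w z\<^sub>0 < \<delta> \<and> u z - v w \<ge> 4 * d"
    if "\<delta> > 0" for \<delta> using \<open>\<delta> > 0\<close> by (meson not_le)
  have SS: "S \<subseteq> {0..T} \<times> UNIV" unfolding S_def by auto
  have usc_u: "usc_on S u"
    using u usc_on_subset[OF _ SS] unfolding BUSC_def usc_on_iff_eventually by blast
  have "usc_on ({0..T} \<times> UNIV) (\<lambda>z. - v z)"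
    using v unfolding BLSC_def usc_on_iff_eventually
    by (simp add: algebra_simps)
  then have usc_v: "usc_on S (\<lambda>z. - v z)" using usc_on_subset[OF _ SS] by blast
  obtain C1 where "\<forall>y\<in>u ` ({0..T} \<times> UNIV). norm y \<le> C1"
    using u unfolding BUSC_def bounded_iff by blast
  then have C1: "\<bar>u z\<bar> \<le> C1" if "z \<in> S" for z using that SS by auto
  obtain C2 where "\<forall>y\<in>v ` ({0..T} \<times> UNIV). norm y \<le> C2"
    using v unfolding BLSC_def bounded_iff by blast
  then have C2: "\<bar>v z\<bar> \<le> C2" if "z \<in> S" for z using that SS by auto
  define C where "C = max 1 (max C1 C2)"
  have C: "C > 0" and bu: "\<And>z. z \<in> S \<Longrightarrow> \<bar>u z\<bar> \<le> C" and bv: "\<And>z. z \<in> S \<Longrightarrow> \<bar>v z\<bar> \<le> C"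
    using C1 C2 unfolding C_def by fastforce+

  \<comment> \<open>The parameters are chosen in this order: each may depend on the previous ones only. The factor \<open>\<alpha>\<close> is so close to one that it costs at most \<open>d\<close>.\<close>
  define \<alpha> where "\<alpha> = C / (C + d)"
  have \<alpha>: "0 < \<alpha>" "\<alpha> < 1" and \<alpha>C: "(1 - \<alpha>) * C \<le> d"
    unfolding \<alpha>_def using C \<open>d > 0\<close> by (auto simp: field_simps)
  have \<alpha>v: "\<bar>(1 - \<alpha>) * v z\<bar> \<le> d" if "z \<in> S" for z
  proof -
    have "\<bar>(1 - \<alpha>) * v z\<bar> \<le> (1 - \<alpha>) * C"
      using \<alpha> bv[OF that] by (simp add: abs_mult mult_left_mono)
    then show ?thesis using \<alpha>C by simp
  qed
  have \<alpha>v': "\<bar>\<alpha> * v z\<bar> \<le> C" if "z \<in> S" for z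
  proof -
    have "\<bar>\<alpha> * v z\<bar> \<le> 1 * \<bar>v z\<bar>" using \<alpha> by (simp add: abs_mult mult_left_le_one_le)
    then show ?thesis using bv[OF that] by linarith
  qed
  define \<gamma> where "\<gamma> = d / (2 * T)"
  have \<gamma>: "\<gamma> > 0" "\<gamma> * T = d / 2" unfolding \<gamma>_def using \<open>T > 0\<close> \<open>d > 0\<close> by auto
  \<comment> \<open>The final estimate reads \<open>m \<le> 16 B\<^sup>2 C \<beta> + 128 L\<^sup>2 e\<close>, and \<open>\<beta>\<close> and \<open>e\<close> make each term at most \<open>m / 4\<close>.\<close>
  define m where "m = \<gamma> * (1 - \<alpha>)"
  have m: "m > 0" unfolding m_def using \<gamma> \<alpha> by simp
  \<comment> \<open>The points in question lie near \<open>z\<^sub>0\<close>, hence in the ball of radius \<open>X\<close>, where the confining term costs at most \<open>d / 2\<close>.\<close>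
  define X where "X = norm (snd z\<^sub>0) + 1"
  have X: "X > 0" unfolding X_def by (simp add: add_nonneg_pos)
  define \<beta> where "\<beta> = min (d / (2 * X\<^sup>2)) (m / (64 * B\<^sup>2 * C + 1))"
  have den: "64 * B\<^sup>2 * C + 1 > 0" "512 * L\<^sup>2 + 1 > 0"
    using C by (auto intro!: add_nonneg_pos)
  have \<beta>: "\<beta> > 0" unfolding \<beta>_def using \<open>d > 0\<close> X m den by simp
  have \<beta>X: "\<beta> * X\<^sup>2 \<le> d / 2"
  proof -
    have "\<beta> * X\<^sup>2 \<le> d / (2 * X\<^sup>2) * X\<^sup>2" unfolding \<beta>_def by (intro mult_right_mono) auto
    then show ?thesis using X by simp
  qed
  have \<beta>m: "\<beta> * (64 * B\<^sup>2 * C + 1) \<le> m"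
  proof -
    have "\<beta> * (64 * B\<^sup>2 * C + 1) \<le> m / (64 * B\<^sup>2 * C + 1) * (64 * B\<^sup>2 * C + 1)"
      unfolding \<beta>_def using den by (intro mult_right_mono) auto
    then show ?thesis using den by simp
  qed
  define e where "e = min 1 (min (d / 8) (m / (512 * L\<^sup>2 + 1)))"
  have e: "e > 0" "e \<le> 1" unfolding e_def using \<open>d > 0\<close> m den by auto
  have e_d: "e \<le> d / 8" unfolding e_def by (rule min.coboundedI2[OF min.cobounded1])
  have em: "e * (512 * L\<^sup>2 + 1) \<le> m"
  proof -
    have "e * (512 * L\<^sup>2 + 1) \<le> m / (512 * L\<^sup>2 + 1) * (512 * L\<^sup>2 + 1)"
      unfolding e_def using den by (intro mult_right_mono) auto
    then show ?thesis using den by simp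
  qed

  let ?D = "doubled u v \<alpha> \<gamma> \<beta>"
  have D_le: "?D p \<le> 2 * C" if "p \<in> S \<times> S" for p
  proof -
    have "u (fst p) \<le> C" "- (\<alpha> * v (snd p)) \<le> C" using bu[of "fst p"] \<alpha>v'[of "snd p"] that by auto
    moreover have "\<gamma> * fst (fst p) \<ge> 0" using that \<gamma> by (auto simp: S_def)
    moreover have "\<beta> * (norm (snd (fst p)))\<^sup>2 \<ge> 0" using \<beta> by simp
    ultimately show ?thesis unfolding doubled_def by linarith
  qed
  have big: "\<exists>p\<in>S \<times> S. ?D p - k * separation p \<ge> 3 * d / 2" if "k > 0" for k
  proof -
    define \<delta> where "\<delta> = min 1 (sqrt (d / (8 * k)))"
    have \<delta>: "\<delta> > 0" "\<delta> \<le> 1" unfolding \<delta>_def using \<open>d > 0\<close> \<open>k > 0\<close> by auto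
    have "\<delta>\<^sup>2 \<le> (sqrt (d / (8 * k)))\<^sup>2" using \<delta>(1) unfolding \<delta>_def by (intro power_mono) auto
    then have k\<delta>: "k * (2 * \<delta>)\<^sup>2 \<le> d / 2"
      using \<open>d > 0\<close> \<open>k > 0\<close> by (simp add: field_simps)
    obtain z w where zw: "z \<in> S" "w \<in> S" "dist z z\<^sub>0 < \<delta>" "dist w z\<^sub>0 < \<delta>" "u z - v w \<ge> 4 * d"
      using gap[OF \<delta>(1)] by blast
    have "norm (z - w) \<le> 2 * \<delta>"
      using dist_triangle2[of z w z\<^sub>0] zw by (simp add: dist_norm)
    then have "(norm (z - w))\<^sup>2 \<le> (2 * \<delta>)\<^sup>2" by (intro power_mono) auto
    then have "k * (norm (z - w))\<^sup>2 \<le> k * (2 * \<delta>)\<^sup>2" using \<open>k > 0\<close> by simp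
    then have 1: "k * (norm (z - w))\<^sup>2 \<le> d / 2" using k\<delta> by simp
    have "norm (snd z - snd z\<^sub>0) < 1"
      using zw(3) \<delta>(2) dist_snd_le[of z z\<^sub>0] by (simp add: dist_norm)
    then have "norm (snd z) \<le> X" unfolding X_def using norm_triangle_sub[of "snd z" "snd z\<^sub>0"] by simp
    then have "(norm (snd z))\<^sup>2 \<le> X\<^sup>2" by (intro power_mono) auto
    then have "\<beta> * (norm (snd z))\<^sup>2 \<le> \<beta> * X\<^sup>2" using \<beta> by simp
    then have 2: "\<beta> * (norm (snd z))\<^sup>2 \<le> d / 2" using \<beta>X by simp
    have "fst z \<le> T" using zw(1) by (auto simp: S_def)
    then have 3: "\<gamma> * fst z \<le> d / 2" using \<gamma> mult_left_mono[OF \<open>fst z \<le> T\<close>, of \<gamma>] by linarith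
    have "u z - \<alpha> * v w \<ge> 3 * d" using zw(5) \<alpha>v[OF zw(2)] by (simp add: algebra_simps abs_le_iff)
    with 1 2 3 have "?D (z, w) - k * separation (z, w) \<ge> 3 * d / 2"
      unfolding doubled_def separation_def by simp
    then show ?thesis using zw by blast
  qed

  \<comment> \<open>At initial points in the ball that contains all doubled maxima, \<open>u\<close> exceeds \<open>\<alpha> v\<close> by at most \<open>d\<close>.\<close>
  define R where "R = sqrt (2 * C / \<beta>) + 1"
  define K where "K = {0::real} \<times> cball (0::real^'n) R"
  have K: "compact K" unfolding K_def by (intro compact_Times) auto
  have KS: "K \<subseteq> S" unfolding K_def S_def using \<open>T > 0\<close> by auto
  have usc_G: "usc_on (S \<times> S) (\<lambda>p. u (fst p) + \<alpha> * (- v (snd p)))"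
    by (intro usc_on_add usc_on_cmult[OF _ \<alpha>(1)] usc_on_fst[OF usc_u] usc_on_snd[OF usc_v])
  have diag: "u (fst (z, z)) + \<alpha> * (- v (snd (z, z))) < 5 * d / 4" if "z \<in> K" for z
  proof -
    have "u z \<le> v z" using init that unfolding K_def by auto
    moreover have "(1 - \<alpha>) * v z \<le> d" using \<alpha>v[of z] that KS by auto
    ultimately show ?thesis using \<open>d > 0\<close> by (simp add: algebra_simps)
  qed
  obtain \<delta> where \<delta>: "\<delta> > 0"
    "\<And>z z1 z2. z \<in> K \<Longrightarrow> z1 \<in> S \<Longrightarrow> z2 \<in> S \<Longrightarrow> dist z z1 < \<delta> \<Longrightarrow> dist z z2 < \<delta>
      \<Longrightarrow> u z1 - \<alpha> * v z2 < 5 * d / 4"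
  proof (rule usc_bound_near_diagonal[OF K KS usc_G diag])
    fix \<delta> :: real
    assume "\<delta> > 0" and *: "\<And>z z1 z2. z \<in> K \<Longrightarrow> z1 \<in> S \<Longrightarrow> z2 \<in> S \<Longrightarrow> dist z z1 < \<delta> \<Longrightarrow>
      dist z z2 < \<delta> \<Longrightarrow> u (fst (z1, z2)) + \<alpha> * (- v (snd (z1, z2))) < 5 * d / 4"
    show thesis
    proof (rule that[OF \<open>\<delta> > 0\<close>])
      fix z z1 z2 assume "z \<in> K" "z1 \<in> S" "z2 \<in> S" "dist z z1 < \<delta>" "dist z z2 < \<delta>"
      from *[OF this] show "u z1 - \<alpha> * v z2 < 5 * d / 4" by simp
    qed
  qed
  \<comment> \<open>For \<open>k \<ge> 4 e / r\<^sup>2\<close> the bound \<open>2 e\<close> on the coupling term forces a distance below \<open>r\<close>.\<close>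
  define r where "r = min \<delta> 1"
  have r: "r > 0" "r \<le> \<delta>" "r \<le> 1" unfolding r_def using \<delta> by auto
  have N: "4 * e / r\<^sup>2 > 0" using e r by simp

  obtain k p' where k: "k \<ge> 4 * e / r\<^sup>2" and p': "p' \<in> S \<times> S"
    and p'_val: "?D p' - 2 * k * separation p' \<ge> 3 * d / 2 - e"
    and p'_near: "\<And>q. q \<in> S \<times> S \<Longrightarrow> ?D q - k * separation q \<le> ?D p' - 2 * k * separation p' + e"
  proof (rule doubling_near_max[of "S \<times> S" separation ?D "2 * C" "3 * d / 2" "4 * e / r\<^sup>2" e])
    show "separation p \<ge> 0" for p :: "(real \<times> (real^'n)) \<times> (real \<times> (real^'n))"
      unfolding separation_def by simp
  qed (use D_le big N e in auto)
  have kpos: "k > 0" using N k by linarith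
  \<comment> \<open>With this \<open>\<eta>\<close> the barrier costs exactly \<open>e\<close> at the almost maximal pair \<open>p'\<close>.\<close>
  define \<eta> where "\<eta> = e / (1 / (T - fst (fst p')) + 1 / (T - fst (snd p')))"
  have p'T: "1 / (T - fst (fst p')) + 1 / (T - fst (snd p')) > 0"
    using p' by (auto simp: S_def intro!: add_pos_pos)
  then have \<eta>: "\<eta> > 0" unfolding \<eta>_def using e by simp
  have "barrier T \<eta> p' = \<eta> * (1 / (T - fst (fst p')) + 1 / (T - fst (snd p')))"
    unfolding barrier_def by (simp add: distrib_left)
  then have bar: "barrier T \<eta> p' = e" unfolding \<eta>_def using p'T by simp
  obtain p where p: "p \<in> S \<times> S" and
    p_max: "\<And>q. q \<in> S \<times> S \<Longrightarrow> ?D q - 2 * k * separation q - barrier T \<eta> q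
       \<le> ?D p - 2 * k * separation p - barrier T \<eta> p"
    using penalized_doubling_attains_max[of T u C v \<alpha> "2 * k" \<gamma> \<beta> \<eta>]
      \<open>T > 0\<close> bu bv usc_u usc_v \<alpha> kpos \<gamma> \<beta> \<eta> unfolding S_def by (metis less_imp_le mult_pos_pos zero_less_numeral)
  obtain t x s y where pe: "p = ((t, x), (s, y))" by (metis surj_pair)
  have S: "(t, x) \<in> S" "(s, y) \<in> S" and t: "0 \<le> t" "t < T" and s: "0 \<le> s" "s < T"
    using p unfolding pe S_def by auto
  have "barrier T \<eta> p \<ge> 0" unfolding pe barrier_def using t s \<eta> by simp
  with p_max[OF p'] bar have pval: "?D p - 2 * k * separation p \<ge> ?D p' - 2 * k * separation p' - e"
    by linarith
  with p'_near[OF p] have ksep: "k * separation p \<le> 2 * e" by linarith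
  from pval p'_val e_d have Dp: "?D p - 2 * k * separation p \<ge> 5 * d / 4" by linarith
  have nn: "k * separation p \<ge> 0" "\<gamma> * t \<ge> 0" "\<beta> * (norm x)\<^sup>2 \<ge> 0"
    using kpos \<gamma> \<beta> t unfolding separation_def by auto
  have uv: "u (t, x) - \<alpha> * v (s, y) \<ge> 5 * d / 4 + \<beta> * (norm x)\<^sup>2"
    using Dp nn unfolding pe doubled_def by simp
  moreover have "u (t, x) \<le> C" "- (\<alpha> * v (s, y)) \<le> C" using bu[OF S(1)] \<alpha>v'[OF S(2)] by auto
  ultimately have \<beta>x: "\<beta> * (norm x)\<^sup>2 \<le> 2 * C" using \<open>d > 0\<close> by linarith
  then have xR: "norm x \<le> R - 1"
    unfolding R_def using \<beta> by (simp add: real_le_rsqrt field_simps)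
  have dist_r: "dist (t, x) (s, y) < r"
  proof -
    have "4 * e / r\<^sup>2 * separation p \<le> k * separation p"
      using k unfolding separation_def by (intro mult_right_mono) auto
    with ksep have "4 * e / r\<^sup>2 * separation p \<le> 2 * e" by linarith
    then have "separation p \<le> r\<^sup>2 / 2" using e r by (simp add: field_simps)
    moreover have "r\<^sup>2 > 0" using r by simp
    ultimately have "separation p < r\<^sup>2" by linarith
    then have "(dist (t, x) (s, y))\<^sup>2 < r\<^sup>2"
      unfolding pe separation_def dist_norm by simp
    then show ?thesis by (rule power2_less_imp_less) (use r in simp)
  qed
  have yR: "norm y \<le> R"
  proof -
    have "dist x y < 1" using dist_snd_le[of "(t, x)" "(s, y)"] dist_r r by simp
    then show ?thesis using xR norm_triangle_sub[of y x] by (simp add: dist_norm norm_minus_commute)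
  qed
  have contra: False if "z \<in> K" "dist z (t, x) < \<delta>" "dist z (s, y) < \<delta>" for z
    using \<delta>(2)[OF that(1) S that(2,3)] uv nn by simp
  have "t > 0"
  proof (rule ccontr)
    assume "\<not> t > 0"
    then have "(t, x) \<in> K" unfolding K_def using t xR by simp
    then show False using contra[of "(t, x)"] dist_r r by simp
  qed
  moreover have "s > 0"
  proof (rule ccontr)
    assume "\<not> s > 0"
    then have "(s, y) \<in> K" unfolding K_def using s yR by simp
    then show False using contra[of "(s, y)"] dist_r r by (simp add: dist_commute)
  qed
  ultimately have "\<gamma> \<le> H x ((2 * (2 * k)) *\<^sub>R (x - y) + (2 * \<beta>) *\<^sub>R x) - H y ((2 * (2 * k)) *\<^sub>R (x - y)) / \<alpha>"
    using viscosity_inequality_at_doubled_max[OF sub super homogeneous \<alpha>(1) \<eta>, of \<gamma> \<beta> "2 * k" t x s y]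
      p_max t s unfolding pe S_def by blast
  also have "\<dots> \<le> (B * norm ((2 * \<beta>) *\<^sub>R x) + L * norm (x - y) * norm ((2 * (2 * k)) *\<^sub>R (x - y)))\<^sup>2 / (1 - \<alpha>)"
    using perturb[OF \<alpha>, of x "(2 * (2 * k)) *\<^sub>R (x - y)" "(2 * \<beta>) *\<^sub>R x" y] by simp
  also have "B * norm ((2 * \<beta>) *\<^sub>R x) + L * norm (x - y) * norm ((2 * (2 * k)) *\<^sub>R (x - y))
      = 2 * B * (\<beta> * norm x) + 4 * L * (k * (norm (x - y))\<^sup>2)"
    using \<beta> kpos by (simp add: power2_eq_square)
  finally have "m \<le> (2 * B * (\<beta> * norm x) + 4 * L * (k * (norm (x - y))\<^sup>2))\<^sup>2"
    unfolding m_def using \<alpha> by (simp add: field_simps)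
  also have "\<dots> \<le> 2 * (2 * B * (\<beta> * norm x))\<^sup>2 + 2 * (4 * L * (k * (norm (x - y))\<^sup>2))\<^sup>2"
    using sum_squares_bound[of "2 * B * (\<beta> * norm x)" "4 * L * (k * (norm (x - y))\<^sup>2)"]
    by (simp add: power2_sum)
  also have "\<dots> = 8 * B\<^sup>2 * (\<beta> * norm x)\<^sup>2 + 32 * L\<^sup>2 * (k * (norm (x - y))\<^sup>2)\<^sup>2"
    by (simp add: power_mult_distrib)
  also have "\<dots> \<le> 8 * B\<^sup>2 * (\<beta> * (2 * C)) + 32 * L\<^sup>2 * (4 * e)"
  proof (intro add_mono mult_left_mono)
    show "(\<beta> * norm x)\<^sup>2 \<le> \<beta> * (2 * C)"
      using mult_left_mono[OF \<beta>x, of \<beta>] \<beta> by (simp add: power2_eq_square mult_ac)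
    have "(norm (x - y))\<^sup>2 \<le> separation p"
      using norm_snd_le[of "x - y" "t - s"] unfolding pe separation_def
      by (intro power_mono) auto
    then have "k * (norm (x - y))\<^sup>2 \<le> 2 * e"
      using kpos ksep mult_left_mono[of "(norm (x - y))\<^sup>2" "separation p" k] by linarith
    then have "(k * (norm (x - y))\<^sup>2)\<^sup>2 \<le> (2 * e)\<^sup>2" using kpos by (intro power_mono) auto
    also have "\<dots> \<le> 4 * e" using e by (simp add: power2_eq_square mult_left_le)
    finally show "(k * (norm (x - y))\<^sup>2)\<^sup>2 \<le> 4 * e" .
  qed auto
  finally show False using \<beta>m em \<beta> e m by (simp add: algebra_simps)
qed

lemma usc_extended_to_approx:
  assumes "usc_extended_to T u" "\<delta> > 0" "\<epsilon> > 0"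
  obtains z where "z \<in> {0<..<T} \<times> UNIV" "dist z (T, x) < \<delta>" "u z > u (T, x) - \<epsilon>"
proof (rule ccontr)
  assume "\<not> thesis"
  with that have "\<forall>\<^sub>F z in at (T, x) within {0<..<T} \<times> UNIV. ereal (u z) \<le> ereal (u (T, x) - \<epsilon>)"
    unfolding eventually_at using \<open>\<delta> > 0\<close> by (intro exI[of _ \<delta>]) (auto simp: not_less[symmetric])
  then have "Limsup (at (T, x) within {0<..<T} \<times> UNIV) (\<lambda>z. ereal (u z)) \<le> ereal (u (T, x) - \<epsilon>)"
    by (rule Limsup_bounded)
  moreover have "ereal (u (T, x)) = Limsup (at (T, x) within {0<..<T} \<times> UNIV) (\<lambda>z. ereal (u z))"
    using assms(1) unfolding usc_extended_to_def by blast
  ultimately have "ereal (u (T, x)) \<le> ereal (u (T, x) - \<epsilon>)" by simp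
  then show False using \<open>\<epsilon> > 0\<close> by simp
qed

lemma lsc_extended_to_iff_uminus: "lsc_extended_to T v \<longleftrightarrow> usc_extended_to T (\<lambda>z. - v z)"
proof -
  have "(ereal a = Liminf F (\<lambda>z. ereal (f z))) \<longleftrightarrow> (ereal (- a) = Limsup F (\<lambda>z. ereal (- f z)))"
    for a and F :: "(real \<times> (real^'n)) filter" and f
  proof -
    have "Limsup F (\<lambda>z. ereal (- f z)) = - Liminf F (\<lambda>z. ereal (f z))"
      using ereal_Limsup_uminus[of F "\<lambda>z. ereal (f z)"] by simp
    then show ?thesis
      using ereal_uminus_eq_iff[of "ereal a" "Liminf F (\<lambda>z. ereal (f z))"] by simp
  qed
  then show ?thesis
    unfolding lsc_extended_to_def usc_extended_to_def by blast
qed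

theorem theorem4p3:
  fixes T \<theta> :: real
    and M :: "'w measure" and W :: "real \<Rightarrow> 'w \<Rightarrow> real^'r"
    and \<sigma> :: "real^'n \<Rightarrow> real^'m \<Rightarrow> real^'r^'n"
    and b :: "real^'m \<Rightarrow> real^'m" and \<tau> :: "real^'m \<Rightarrow> real^'r^'m"
    and \<mu> :: "(real^'m) measure"
    and u v :: "real \<times> (real^'n) \<Rightarrow> real"
  assumes "T > 0"
    and "brownian_motion M W"
    and "bounded (range (\<lambda>(x, y). \<sigma> x y))"
    and "\<exists>L. L-lipschitz_on UNIV (\<lambda>(x, y). \<sigma> x y)"
    and "\<And>x. periodic (\<sigma> x)"
    and "locally_lipschitz b" and "periodic b"
    and "locally_lipschitz \<tau>" and "periodic \<tau>"
    and "\<theta> > 0"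
    and "\<And>y \<xi>. \<xi> \<noteq> 0 \<Longrightarrow> (norm (transpose (\<tau> y) *v \<xi>))\<^sup>2 > \<theta> * (norm \<xi>)\<^sup>2"
    and "invariant_measure M W b (\<lambda>y. sqrt 2 *\<^sub>R \<tau> y) \<mu>"
    and "u \<in> BUSC ({0..T} \<times> UNIV)" and "v \<in> BLSC ({0..T} \<times> UNIV)"
    and "viscosity_subsolution ({0<..<T} \<times> UNIV) (limit_equation \<sigma> \<mu>) u"
    and "viscosity_supersolution ({0<..<T} \<times> UNIV) (limit_equation \<sigma> \<mu>) v"
    and "\<And>x. u (0, x) \<le> v (0, x)"
  shows "(\<forall>x. \<forall>t\<in>{0..<T}. u (t, x) \<le> v (t, x)) \<and>
    (usc_extended_to T u \<and> lsc_extended_to T v \<longrightarrow> (\<forall>x. \<forall>t\<in>{0..T}. u (t, x) \<le> v (t, x)))"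
proof -
  obtain B where "\<forall>z\<in>range (\<lambda>(x, y). \<sigma> x y). norm z \<le> B"
    using assms(3) unfolding bounded_iff by blast
  then have B: "norm (\<sigma> x y) \<le> B" for x y by (force simp: image_iff)
  obtain L where L: "L-lipschitz_on UNIV (\<lambda>(x, y). \<sigma> x y)" using assms(4) by blast
  have \<mu>: "prob_space \<mu>" "sets \<mu> = sets torus"
    using assms(12) unfolding invariant_measure_def by auto
  let ?H = "effective_hamiltonian \<sigma> \<mu>"
  have eq: "limit_equation \<sigma> \<mu> = (\<lambda>x q p. q - ?H x p)"
    by (simp add: fun_eq_iff limit_equation_def effective_hamiltonian_def)
  have close: thesis
    if "d > 0" "\<And>\<delta>. \<delta> > 0 \<Longrightarrow> (\<And>z w. z \<in> {0..<T} \<times> UNIV \<Longrightarrow> w \<in> {0..<T} \<times> UNIV \<Longrightarrow>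
      dist z z\<^sub>0 < \<delta> \<Longrightarrow> dist w z\<^sub>0 < \<delta> \<Longrightarrow> u z - v w < 4 * d) \<Longrightarrow> thesis"
    for z\<^sub>0 d thesis
    by (rule comparison_up_to_closure[where H = "?H" and B = B and L = L and z\<^sub>0 = z\<^sub>0, OF \<open>T > 0\<close>
        effective_hamiltonian_scaleR effective_hamiltonian_perturb[OF \<mu> B L]
        assms(13,14) assms(15,16)[unfolded eq] assms(17) that])
  have before: "u (t, x) \<le> v (t, x)" if "t \<in> {0..<T}" for t x
  proof (rule field_le_epsilon)
    fix \<epsilon> :: real assume "\<epsilon> > 0"
    then have "\<epsilon> / 4 > 0" by simp
    then obtain \<delta> where "\<delta> > 0" "\<And>z w. z \<in> {0..<T} \<times> UNIV \<Longrightarrow> w \<in> {0..<T} \<times> UNIV \<Longrightarrow>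
      dist z (t, x) < \<delta> \<Longrightarrow> dist w (t, x) < \<delta> \<Longrightarrow> u z - v w < 4 * (\<epsilon> / 4)"
      by (rule close[of _ "(t, x)"]) blast
    from this(2)[of "(t, x)" "(t, x)"] that this(1) show "u (t, x) \<le> v (t, x) + \<epsilon>" by simp
  qed
  have final: "u (T, x) \<le> v (T, x)" if ext: "usc_extended_to T u" "lsc_extended_to T v" for x
  proof (rule field_le_epsilon)
    fix \<epsilon> :: real assume "\<epsilon> > 0"
    then have "\<epsilon> / 4 > 0" by simp
    then obtain \<delta> where \<delta>: "\<delta> > 0" "\<And>z w. z \<in> {0..<T} \<times> UNIV \<Longrightarrow> w \<in> {0..<T} \<times> UNIV \<Longrightarrow>
      dist z (T, x) < \<delta> \<Longrightarrow> dist w (T, x) < \<delta> \<Longrightarrow> u z - v w < 4 * (\<epsilon> / 8)"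
      using close[of "\<epsilon> / 8" "(T, x)"] by auto
    obtain z where z: "z \<in> {0<..<T} \<times> UNIV" "dist z (T, x) < \<delta>" "u z > u (T, x) - \<epsilon> / 4"
      using usc_extended_to_approx[OF ext(1) \<delta>(1) \<open>\<epsilon> / 4 > 0\<close>] .
    obtain w where w: "w \<in> {0<..<T} \<times> UNIV" "dist w (T, x) < \<delta>" "- v w > - v (T, x) - \<epsilon> / 4"
      using usc_extended_to_approx[OF ext(2)[unfolded lsc_extended_to_iff_uminus] \<delta>(1) \<open>\<epsilon> / 4 > 0\<close>] .
    have "u z - v w < 4 * (\<epsilon> / 8)" using z w by (intro \<delta>(2)) auto
    with z(3) w(3) show "u (T, x) \<le> v (T, x) + \<epsilon>" by linarith
  qed
  show ?thesis
  proof (intro conjI allI ballI impI)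
    fix x t assume "t \<in> {0..<T}"
    then show "u (t, x) \<le> v (t, x)" by (rule before)
  next
    fix x t assume "usc_extended_to T u \<and> lsc_extended_to T v" "t \<in> {0..T}"
    then show "u (t, x) \<le> v (t, x)" using before final by (cases "t = T") auto
  qed
qed

end
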